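(* Let $q$ be a complex number with $|q|<1$, and let $$R(q):=\sum_{n=0}^{\infty}\frac{q^{\binom{n+1}{2}}}{(-q;q)_n}.$$ Then $$\sum_{n=1}^{\infty}\frac{q^n}{(q^n;q)_{n+1}(q^{2n+1};q^2)_{\infty}}=-\frac12 R(q)+\frac{1}{(q;q^2)_{\infty}}\sum_{n=0}^{\infty}\frac{q^n}{1+q^n}.$$
   Context: Notation: $(a;q)_n:=\prod_{j=0}^{n-1}(1-aq^j)$ for $n\ge 0$ (empty product equal to 1) and $(a;q)_\infty:=\lim_{n\to\infty}(a;q)_n$. *)

theory Defs
  imports "HOL-Analysis.Analysis"
begin

definition qpoch :: "complex \<Rightarrow> complex \<Rightarrow> nat \<Rightarrow> complex" where
  "qpoch a q n = (\<Prod>j<n. 1 - a * q ^ j)"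

definition qpoch_inf :: "complex \<Rightarrow> complex \<Rightarrow> complex" where
  "qpoch_inf a q = lim (\<lambda>n. qpoch a q n)"

definition R :: "complex \<Rightarrow> complex" where
  "R q = (\<Sum>n. q ^ (Suc n choose 2) / qpoch (-q) q n)"

text \<open>The operators \<^const>\<open>lim\<close> and \<^const>\<open>suminf\<close> and division are total in HOL. The facts
  below show that, for \<open>norm q < 1\<close>, every limit and series used converges and that no
  denominator vanishes.\<close>

lemma convergent_prod_qpoch:
  assumes "norm q < 1"
  shows "convergent_prod (\<lambda>j. 1 - a * q ^ j :: complex)"
proof -
  have "summable (\<lambda>j. norm a * norm q ^ j)"
    using assms by (intro summable_mult summable_geometric) auto
  then show ?thesis
    by (intro abs_convergent_prod_imp_convergent_prod summable_imp_abs_convergent_prod)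
       (simp add: norm_mult norm_power)
qed

lemma qpoch_tendsto:
  assumes "norm q < 1"
  shows "qpoch a q \<longlonglongrightarrow> qpoch_inf a q"
proof -
  have "(\<lambda>n. \<Prod>j<n. 1 - a * q ^ j) \<longlonglongrightarrow> prodinf (\<lambda>j. 1 - a * q ^ j)"
    using convergent_prod_LIMSEQ[OF convergent_prod_qpoch[OF assms]]
    by (simp add: LIMSEQ_lessThan_iff_atMost)
  then have "convergent (qpoch a q)"
    unfolding qpoch_def[abs_def] by (rule convergentI)
  then show ?thesis
    by (simp add: qpoch_inf_def convergent_LIMSEQ_iff)
qed

lemma qpoch_lower_bound:
  fixes r :: real
  assumes r: "0 \<le> r" "r < 1"
  obtains c where "c > 0"
    "\<And>a p n. norm a \<le> r \<Longrightarrow> norm p \<le> r \<Longrightarrow> c \<le> norm (qpoch a p n)"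
    "\<And>a p. norm a \<le> r \<Longrightarrow> norm p \<le> r \<Longrightarrow> c \<le> norm (qpoch_inf a p)"
proof -
  define f where "f = (\<lambda>j. 1 - r ^ Suc j)"
  define c where "c = prodinf f"
  have f01: "0 < f j" "f j \<le> 1" for j
    using r power_Suc_less_one[of r j] by (cases "r = 0"; auto simp: f_def)+
  have "summable (\<lambda>j. r * r ^ j)"
    using r by (intro summable_mult summable_geometric) auto
  then have cp: "convergent_prod f"
    using r unfolding f_def
    by (intro abs_convergent_prod_imp_convergent_prod summable_imp_abs_convergent_prod)
       (simp add: abs_mult)
  have lim: "(\<lambda>n. \<Prod>j<n. f j) \<longlonglongrightarrow> c"
    using convergent_prod_LIMSEQ[OF cp] by (simp add: LIMSEQ_lessThan_iff_atMost c_def)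
  have "c \<noteq> 0"
    unfolding c_def using cp f01(1) by (intro prodinf_nonzero) (auto simp: less_le)
  moreover have "0 \<le> c"
    using lim f01(1) by (intro LIMSEQ_le_const[OF lim]) (auto intro!: prod_nonneg simp: less_imp_le)
  ultimately have c0: "c > 0" by simp
  have "decseq (\<lambda>n. \<Prod>j<n. f j)"
  proof (rule decseq_SucI)
    fix n
    have "(\<Prod>j<n. f j) * f n \<le> (\<Prod>j<n. f j) * 1"
      using f01 by (intro mult_left_mono prod_nonneg) (auto simp: less_imp_le)
    then show "(\<Prod>j<Suc n. f j) \<le> (\<Prod>j<n. f j)" by simp
  qed
  then have c_le: "c \<le> (\<Prod>j<n. f j)" for n
    using lim by (rule decseq_ge)
  have fin: "c \<le> norm (qpoch a p n)" if "norm a \<le> r" "norm p \<le> r" for a p n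
  proof -
    have "f j \<le> norm (1 - a * p ^ j)" for j
    proof -
      have "norm (a * p ^ j) \<le> r * r ^ j"
        using that r by (auto simp: norm_mult norm_power intro!: mult_mono power_mono)
      moreover have "1 - norm (a * p ^ j) \<le> norm (1 - a * p ^ j)"
        using norm_triangle_ineq2[of 1 "a * p ^ j"] by simp
      ultimately show ?thesis by (simp add: f_def)
    qed
    then have "(\<Prod>j<n. f j) \<le> (\<Prod>j<n. norm (1 - a * p ^ j))"
      using f01(1) by (intro prod_mono) (auto simp: less_imp_le)
    with c_le[of n] show ?thesis by (simp add: qpoch_def prod_norm)
  qed
  have "c \<le> norm (qpoch_inf a p)" if "norm a \<le> r" "norm p \<le> r" for a p
  proof -
    have "norm p < 1" using that r by simp
    from tendsto_norm[OF qpoch_tendsto[OF this, of a]] show ?thesis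
      using fin[OF that] by (intro LIMSEQ_le_const) auto
  qed
  with c0 fin show thesis by (intro that) auto
qed

lemma norm_power_le_norm:
  fixes q :: complex
  assumes "norm q < 1" "m \<ge> 1"
  shows "norm (q ^ m) \<le> norm q"
  using power_decreasing[of 1 m "norm q"] assms by (simp add: norm_power)

lemma qpoch_nonzero:
  assumes "norm q < 1" "norm a < 1"
  shows "qpoch a q n \<noteq> 0" "qpoch_inf a q \<noteq> 0"
proof -
  obtain c where c: "c > 0"
    "\<And>a' p n. norm a' \<le> max (norm q) (norm a) \<Longrightarrow> norm p \<le> max (norm q) (norm a)
       \<Longrightarrow> c \<le> norm (qpoch a' p n)"
    "\<And>a' p. norm a' \<le> max (norm q) (norm a) \<Longrightarrow> norm p \<le> max (norm q) (norm a)
       \<Longrightarrow> c \<le> norm (qpoch_inf a' p)"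
    by (rule qpoch_lower_bound[of "max (norm q) (norm a)"]) (use assms in \<open>auto simp: le_max_iff_disj\<close>)
  show "qpoch a q n \<noteq> 0" using c(1) c(2)[of a q n] by auto
  show "qpoch_inf a q \<noteq> 0" using c(1) c(3)[of a q] by auto
qed

lemma summable_R:
  assumes q: "norm q < 1"
  shows "summable (\<lambda>n. q ^ (Suc n choose 2) / qpoch (-q) q n)"
proof -
  obtain c where c: "c > 0"
    "\<And>a p n. norm a \<le> norm q \<Longrightarrow> norm p \<le> norm q \<Longrightarrow> c \<le> norm (qpoch a p n)"
    by (rule qpoch_lower_bound[of "norm q"]) (use q in auto)
  have "summable (\<lambda>n. norm q ^ n / c)"
    using q by (intro summable_divide summable_geometric) auto
  then show ?thesis
  proof (rule summable_comparison_test')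
    fix n :: nat
    have "n \<le> Suc n choose 2" by (simp add: numeral_2_eq_2)
    then have "norm q ^ (Suc n choose 2) \<le> norm q ^ n"
      using q by (intro power_decreasing) auto
    then show "norm (q ^ (Suc n choose 2) / qpoch (-q) q n) \<le> norm q ^ n / c"
      using c(1) c(2)[of "-q" q n]
      by (auto simp: norm_divide norm_power intro!: frac_le)
  qed
qed

lemma summable_lhs:
  assumes q: "norm q < 1"
  shows "summable (\<lambda>n. q ^ Suc n /
    (qpoch (q ^ Suc n) q (Suc n + 1) * qpoch_inf (q ^ (2 * Suc n + 1)) (q ^ 2)))"
proof -
  obtain c where c: "c > 0"
    "\<And>a p n. norm a \<le> norm q \<Longrightarrow> norm p \<le> norm q \<Longrightarrow> c \<le> norm (qpoch a p n)"
    "\<And>a p. norm a \<le> norm q \<Longrightarrow> norm p \<le> norm q \<Longrightarrow> c \<le> norm (qpoch_inf a p)"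
    by (rule qpoch_lower_bound[of "norm q"]) (use q in auto)
  have "summable (\<lambda>n. norm q * norm q ^ n / (c * c))"
    using q by (intro summable_divide summable_mult summable_geometric) auto
  then show ?thesis
  proof (rule summable_comparison_test')
    fix n :: nat
    have "c \<le> norm (qpoch (q ^ Suc n) q (Suc n + 1))"
      using q by (intro c norm_power_le_norm) auto
    moreover have "c \<le> norm (qpoch_inf (q ^ (2 * Suc n + 1)) (q ^ 2))"
      using q by (intro c norm_power_le_norm) auto
    ultimately have "c * c \<le> norm (qpoch (q ^ Suc n) q (Suc n + 1) *
        qpoch_inf (q ^ (2 * Suc n + 1)) (q ^ 2))"
      unfolding norm_mult using c(1) by (intro mult_mono) auto
    moreover have "norm (q ^ Suc n) = norm q * norm q ^ n"
      by (simp add: norm_mult norm_power)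
    ultimately show "norm (q ^ Suc n / (qpoch (q ^ Suc n) q (Suc n + 1) *
        qpoch_inf (q ^ (2 * Suc n + 1)) (q ^ 2))) \<le> norm q * norm q ^ n / (c * c)"
      unfolding norm_divide using c(1) by (intro frac_le) auto
  qed
qed

lemma one_plus_power_lower_bound:
  fixes q :: complex
  assumes q: "norm q < 1"
  shows "1 - norm q \<le> norm (1 + q ^ n)"
proof (cases "n = 0")
  case True
  have "1 - norm q \<le> 2" using norm_ge_zero[of q] by linarith
  with True show ?thesis by simp
next
  case False
  then have "norm (q ^ n) \<le> norm q" using q by (intro norm_power_le_norm) auto
  then show ?thesis using norm_diff_ineq[of 1 "q ^ n"] by simp
qed

lemma summable_Lambert:
  fixes q :: complex
  assumes q: "norm q < 1"
  shows "summable (\<lambda>n. q ^ n / (1 + q ^ n))"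
proof -
  have "summable (\<lambda>n. norm q ^ n / (1 - norm q))"
    using q by (intro summable_divide summable_geometric) auto
  then show ?thesis
  proof (rule summable_comparison_test')
    fix n :: nat
    show "norm (q ^ n / (1 + q ^ n)) \<le> norm q ^ n / (1 - norm q)"
      unfolding norm_divide norm_power
      using q one_plus_power_lower_bound[OF q, of n] by (intro frac_le) auto
  qed
qed

end

theory Submission
  imports Defs
begin

text \<open>
  Write \<open>P = (-q;q)\<^sub>\<infinity> = 1/(q;q\<^sup>2)\<^sub>\<infinity>\<close>, \<open>L = \<Sum>\<^sub>n\<^sub>\<ge>\<^sub>1 q\<^sup>n/(1-q\<^sup>n)\<close> and
  \<open>\<Lambda> = \<Sum>\<^sub>n\<^sub>\<ge>\<^sub>1 q\<^sup>n/(1+q\<^sup>n)\<close>. The left-hand side collapses to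
  \<open>A = \<Sum>\<^sub>n\<^sub>\<ge>\<^sub>1 q\<^sup>n/(1-q\<^sup>n) (-q\<^sup>n\<^sup>+\<^sup>1;q)\<^sub>\<infinity>\<close>, and the sum \<open>U = \<Sum>\<^sub>n\<^sub>\<ge>\<^sub>0 (P - (-q;q)\<^sub>n)\<close> is evaluated
  in two ways. A telescoping argument in the shift \<open>a \<mapsto> aq\<close> gives \<open>U = P (L + \<Lambda>) - A\<close>. On the other
  hand \<open>2 P (-q;q)\<^sub>n = \<Sum>\<^sub>j q\<^bsup>j(j+1)/2\<^esup>/(q;q)\<^sub>n\<^sub>-\<^sub>j\<close>, summed over all integers \<open>j \<le> n\<close> (a coefficient form of
  Ramanujan's \<open>\<^sub>1\<psi>\<^sub>1\<close> sum), and summation over \<open>n\<close> gives Andrews' identity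
  \<open>U = P (L - 1/2) + R(q)/2\<close>: the symmetry \<open>j \<mapsto> -1-j\<close> of the exponent produces the \<open>-1/2\<close>, and the
  terms with negative \<open>n\<close> produce \<open>R(q)\<close>.
\<close>

section \<open>q-shifted factorials\<close>

lemma qpoch_0 [simp]: "qpoch a q 0 = 1"
  by (simp add: qpoch_def)

lemma qpoch_Suc: "qpoch a q (Suc n) = qpoch a q n * (1 - a * q ^ n)"
  by (simp add: qpoch_def)

lemma qpoch_add: "qpoch a q (m + n) = qpoch a q m * qpoch (a * q ^ m) q n"
  by (induction n) (simp_all add: qpoch_Suc power_add mult.assoc)

lemma qpoch_inf_split:
  assumes "norm q < 1"
  shows "qpoch_inf a q = qpoch a q n * qpoch_inf (a * q ^ n) q"
proof (rule LIMSEQ_unique)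
  show "(\<lambda>m. qpoch a q (m + n)) \<longlonglongrightarrow> qpoch_inf a q"
    using qpoch_tendsto[OF assms] by (rule LIMSEQ_ignore_initial_segment)
  have "(\<lambda>m. qpoch a q n * qpoch (a * q ^ n) q m) \<longlonglongrightarrow> qpoch a q n * qpoch_inf (a * q ^ n) q"
    by (intro tendsto_mult_left qpoch_tendsto assms)
  then show "(\<lambda>m. qpoch a q (m + n)) \<longlonglongrightarrow> qpoch a q n * qpoch_inf (a * q ^ n) q"
    by (simp add: qpoch_add add.commute[of _ n])
qed

lemma qpoch_even_odd: "qpoch a q (2 * n) = qpoch a (q\<^sup>2) n * qpoch (a * q) (q\<^sup>2) n"
proof (induction n)
  case (Suc n)
  have "qpoch a q (2 * Suc n) = qpoch a q (2 * n) * (1 - a * q ^ (2 * n)) * (1 - a * q * q ^ (2 * n))"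
    by (simp add: qpoch_Suc mult.assoc)
  also have "q ^ (2 * n) = (q\<^sup>2) ^ n"
    by (rule power_mult)
  finally show ?case
    unfolding Suc.IH by (simp only: qpoch_Suc mult_ac)
qed simp

lemma qpoch_mult_neg: "qpoch a q n * qpoch (- a) q n = qpoch (a\<^sup>2) (q\<^sup>2) n"
  by (induction n) (simp_all add: qpoch_Suc algebra_simps power2_eq_square)

text \<open>Euler's identity between odd and distinct parts. Splitting exponents by parity gives
  (q;q)_{2n} = (q;q^2)_n (q^2;q^2)_n, and the last factor is (q;q)_n (-q;q)_n; in the limit the
  nonzero (q;q)_inf cancels.\<close>

lemma qpoch_inf_odd_mult_neg:
  assumes "norm q < 1"
  shows "qpoch_inf q (q\<^sup>2) * qpoch_inf (- q) q = 1"
proof -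
  have q2: "norm (q\<^sup>2) < 1"
    using assms norm_power_le_norm[of q 2] by simp
  have "(\<lambda>n. qpoch q q (n * 2)) \<longlonglongrightarrow> qpoch_inf q q"
    using LIMSEQ_linear[OF qpoch_tendsto[OF assms, of q], of 2] by simp
  moreover have "qpoch q q (n * 2) = qpoch q (q\<^sup>2) n * (qpoch q q n * qpoch (- q) q n)" for n
    by (simp add: qpoch_even_odd[of q q n, unfolded mult.commute[of 2]] qpoch_mult_neg power2_eq_square)
  moreover have "(\<lambda>n. qpoch q (q\<^sup>2) n * (qpoch q q n * qpoch (- q) q n))
      \<longlonglongrightarrow> qpoch_inf q (q\<^sup>2) * (qpoch_inf q q * qpoch_inf (- q) q)"
    by (intro tendsto_mult qpoch_tendsto assms q2)
  ultimately have "qpoch_inf q (q\<^sup>2) * (qpoch_inf q q * qpoch_inf (- q) q) = qpoch_inf q q"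
    by (simp only: LIMSEQ_unique)
  then show ?thesis
    using qpoch_nonzero(2)[OF assms assms] by simp
qed

text \<open>Two factorizations of (q;q)_{2n} give (q^n;q)_{n+1} = (q;q^2)_n (1-q^n) (-q;q)_n. The
  first factor completes the tail to (q;q^2)_inf, which Euler's identity turns into
  1/(-q;q)_inf.\<close>

lemma lhs_term_eq:
  assumes q: "norm q < 1" and n: "n > 0"
  shows "q ^ n / (qpoch (q ^ n) q (n + 1) * qpoch_inf (q ^ (2 * n + 1)) (q\<^sup>2))
    = q ^ n / (1 - q ^ n) * qpoch_inf (- (q ^ Suc n)) q"
proof -
  have q2: "norm (q\<^sup>2) < 1"
    using q norm_power_le_norm[of q 2] by simp
  obtain m where m: "n = Suc m"
    using n by (cases n) auto
  have 1: "qpoch q q (2 * n) = qpoch q q m * qpoch (q ^ n) q (n + 1)"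
    using qpoch_add[of q q m "n + 1"] m by (simp add: mult_2)
  have 2: "qpoch q q n = qpoch q q m * (1 - q ^ n)"
    using m by (simp add: qpoch_Suc)
  have 3: "qpoch q q (2 * n) = qpoch q (q\<^sup>2) n * (qpoch q q n * qpoch (- q) q n)"
    by (simp add: qpoch_even_odd qpoch_mult_neg power2_eq_square)
  have 4: "qpoch_inf q (q\<^sup>2) = qpoch q (q\<^sup>2) n * qpoch_inf (q ^ (2 * n + 1)) (q\<^sup>2)"
    using qpoch_inf_split[OF q2, of q n] by (simp add: power_mult)
  have 5: "qpoch_inf (- q) q = qpoch (- q) q n * qpoch_inf (- (q ^ Suc n)) q"
    using qpoch_inf_split[OF q, of "- q" n] by simp
  have nz: "qpoch q q m \<noteq> 0" "qpoch q (q\<^sup>2) n \<noteq> 0" "qpoch (- q) q n \<noteq> 0"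
    using q q2 by (auto simp: qpoch_nonzero)
  have "qpoch (q ^ n) q (n + 1) = qpoch q (q\<^sup>2) n * (1 - q ^ n) * qpoch (- q) q n"
    using 1 nz(1) unfolding 3 2 by (simp add: mult_ac)
  then have "qpoch (q ^ n) q (n + 1) * qpoch_inf (q ^ (2 * n + 1)) (q\<^sup>2) * qpoch_inf (- (q ^ Suc n)) q
     = (1 - q ^ n) * (qpoch_inf q (q\<^sup>2) * qpoch_inf (- q) q)"
    unfolding 4 5 by (simp only: mult_ac)
  then have key: "qpoch (q ^ n) q (n + 1) * qpoch_inf (q ^ (2 * n + 1)) (q\<^sup>2) * qpoch_inf (- (q ^ Suc n)) q
     = 1 - q ^ n"
    by (simp add: qpoch_inf_odd_mult_neg q)
  have "norm (q ^ n) < 1"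
    using q norm_power_le_norm[of q n] n by simp
  then have "1 - q ^ n \<noteq> 0" by auto
  \<comment> \<open>A nonzero product forces both factors to be nonzero, so \<open>key\<close> also
    shows that the denominator does not vanish.\<close>
  moreover have "b / x = b / g * y" if "x * y = g" "g \<noteq> 0" for b x y g :: complex
    using that by auto
  ultimately show ?thesis
    using key by blast
qed

section \<open>Dominated convergence, bounds, and Euler's product expansion\<close>

lemma tannery_sequentially:
  fixes f :: "nat \<Rightarrow> nat \<Rightarrow> 'a :: {real_normed_algebra, banach}"
  assumes "\<And>k. (\<lambda>n. f n k) \<longlonglongrightarrow> g k"
    and "\<And>n k. norm (f n k) \<le> M k"
    and "summable M"
  shows "(\<lambda>n. \<Sum>k. f n k) \<longlonglongrightarrow> (\<Sum>k. g k)"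
  using tannerys_theorem[of "\<lambda>k n. f n k" g sequentially M] assms
  by (simp add: case_prod_unfold)

lemma summable_of_nat_power:
  fixes z :: "'a :: {real_normed_field, banach}"
  assumes "norm z < 1"
  shows "summable (\<lambda>n. of_nat (Suc n) * z ^ n)"
  using geometric_deriv_sums[OF assms] by (rule sums_summable)

lemma norm_power_choose_2_le:
  fixes q :: complex
  assumes "norm q < 1"
  shows "norm (q ^ (Suc n choose 2)) \<le> norm q ^ n"
proof -
  have "n \<le> Suc n choose 2" by (simp add: numeral_2_eq_2)
  then show ?thesis
    using assms by (simp add: norm_power power_decreasing)
qed

lemma power_choose_2_Suc:
  "q ^ (Suc n choose 2) = q ^ (n choose 2) * (q :: 'a :: monoid_mult) ^ n"
  by (simp add: numeral_2_eq_2 flip: power_add) (simp add: add.commute)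

lemma obtain_qpoch_bounds:
  assumes q: "norm q < 1"
  obtains C where "C > 0" "\<And>n. norm (1 / qpoch q q n) \<le> C" "norm (1 / qpoch_inf q q) \<le> C"
proof -
  obtain c where c: "c > 0"
    "\<And>a p n. norm a \<le> norm q \<Longrightarrow> norm p \<le> norm q \<Longrightarrow> c \<le> norm (qpoch a p n)"
    "\<And>a p. norm a \<le> norm q \<Longrightarrow> norm p \<le> norm q \<Longrightarrow> c \<le> norm (qpoch_inf a p)"
    by (rule qpoch_lower_bound[of "norm q"]) (use q in auto)
  show thesis
    by (rule that[of "1 / c"]) (use c in \<open>auto simp: norm_divide intro!: frac_le\<close>)
qed

lemma tendsto_shifted_power:
  fixes q :: complex
  assumes "norm q < 1"
  shows "(\<lambda>N. x * q ^ N) \<longlonglongrightarrow> 0"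
  using tendsto_mult_left[OF LIMSEQ_power_zero[OF assms], of x] by simp

text \<open>The series satisfies V(y) = (1+y) V(yq). Iterating from x produces the finite products
  (-x;q)_N, while V(x q^N) tends to V(0) = 1; all points x q^N stay in the unit disc, where one
  majorant serves.\<close>

lemma euler_qpoch_inf:
  fixes q x :: complex
  assumes q: "norm q < 1" and x: "norm x \<le> 1"
  shows "(\<lambda>k. q ^ (k choose 2) * x ^ k / qpoch q q k) sums qpoch_inf (- x) q"
proof -
  define f where "f y k = q ^ (k choose 2) * y ^ k / qpoch q q k" for y k
  define V where "V y = (\<Sum>k. f y k)" for y
  obtain C where C: "C > 0" "\<And>n. norm (1 / qpoch q q n) \<le> C"
    using obtain_qpoch_bounds[OF q] by blast
  \<comment> \<open>The exponent comes from k choose 2 being at least k - 1; truncated subtraction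
    makes this correct at k = 0 too.\<close>
  define M where "M k = norm q ^ (k - 1) * C" for k
  have M: "summable M"
  proof (subst summable_Suc_iff[symmetric])
    show "summable (\<lambda>k. M (Suc k))"
      unfolding M_def using q by (simp add: summable_mult2 summable_geometric)
  qed
  have f_le: "norm (f y k) \<le> M k" if "norm y \<le> 1" for y k
  proof -
    have "norm (q ^ (k choose 2)) \<le> norm q ^ (k - 1)"
      using norm_power_choose_2_le[OF q, of "k - 1"] by (cases k) (auto simp: numeral_2_eq_2)
    moreover have "norm (y ^ k) \<le> 1"
      using that by (simp add: norm_power power_le_one)
    ultimately have "norm (q ^ (k choose 2) * y ^ k) \<le> norm q ^ (k - 1) * 1"
      unfolding norm_mult by (intro mult_mono) auto
    then have "norm (q ^ (k choose 2) * y ^ k) * norm (1 / qpoch q q k) \<le> norm q ^ (k - 1) * 1 * C"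
      using C by (intro mult_mono) auto
    then show ?thesis
      by (simp add: f_def M_def norm_mult norm_divide)
  qed
  have sm: "summable (f y)" if "norm y \<le> 1" for y
    using summable_comparison_test'[OF M, of 0 "f y"] f_le[OF that] by auto
  have le: "norm (y * q ^ N) \<le> 1" if "norm y \<le> 1" for y N
    using that q by (simp add: norm_mult norm_power mult_le_one power_le_one)
  have step: "V y = (1 + y) * V (y * q)" if y: "norm y \<le> 1" for y
  proof -
    have yq: "norm (y * q) \<le> 1" using le[OF y, of 1] by simp
    have p: "qpoch q q k \<noteq> 0" "1 - q * q ^ k \<noteq> 0" for k
      using qpoch_nonzero(1)[OF q q, of k] qpoch_nonzero(1)[OF q q, of "Suc k"]
      by (auto simp: qpoch_Suc)
    \<comment> \<open>The difference of powers supplies the factor 1 - q^(k+1), which cancels the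
      last factor of (q;q)_{k+1}.\<close>
    have f_Suc: "f y (Suc k) - f (y * q) (Suc k) = y * f (y * q) k" for k
    proof -
      have "f y (Suc k) - f (y * q) (Suc k)
          = q ^ (Suc k choose 2) * y ^ Suc k * (1 - q * q ^ k) / qpoch q q (Suc k)"
        by (simp add: f_def power_mult_distrib ring_distribs diff_divide_distrib mult_ac)
      also have "\<dots> = y * f (y * q) k"
        using p[of k] unfolding power_choose_2_Suc[of q k]
        by (simp add: f_def qpoch_Suc power_mult_distrib mult_ac)
      finally show ?thesis .
    qed
    have "(\<lambda>k. f y (Suc k) - f (y * q) (Suc k)) sums ((V y - f y 0) - (V (y * q) - f (y * q) 0))"
      unfolding V_def using sm[OF y] sm[OF yq]
      by (intro sums_diff) (simp_all add: sums_Suc_iff summable_sums)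
    moreover have "(\<lambda>k. y * f (y * q) k) sums (y * V (y * q))"
      unfolding V_def using sm[OF yq] by (intro sums_mult summable_sums)
    ultimately have "(V y - f y 0) - (V (y * q) - f (y * q) 0) = y * V (y * q)"
      unfolding f_Suc by (rule sums_unique2)
    then show ?thesis
      by (simp add: f_def algebra_simps)
  qed
  have iter: "V x = qpoch (- x) q N * V (x * q ^ N)" for N
  proof (induction N)
    case (Suc N)
    have "x * q ^ Suc N = x * q ^ N * q" by simp
    then show ?case
      using Suc.IH step[OF le[OF x], of N] by (simp only: qpoch_Suc) simp
  qed simp
  have "(\<lambda>N. V (x * q ^ N)) \<longlonglongrightarrow> (\<Sum>k. if k = 0 then 1 else 0)"
    unfolding V_def
  proof (rule tannery_sequentially[OF _ f_le[OF le[OF x]] M])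
    fix k
    have "(\<lambda>N. f (x * q ^ N) k) \<longlonglongrightarrow> f 0 k"
      unfolding f_def using qpoch_nonzero(1)[OF q q] tendsto_shifted_power[OF q]
      by (intro tendsto_intros) auto
    then show "(\<lambda>N. f (x * q ^ N) k) \<longlonglongrightarrow> (if k = 0 then 1 else 0)"
      by (simp add: f_def power_0_left binomial_eq_0 split: if_splits)
  qed
  then have "(\<lambda>N. qpoch (- x) q N * V (x * q ^ N)) \<longlonglongrightarrow> qpoch_inf (- x) q * 1"
    using suminf_finite[of "{0}" "\<lambda>k. if k = 0 then 1 else (0::complex)"]
    by (intro tendsto_mult qpoch_tendsto q) simp
  then have "V x = qpoch_inf (- x) q"
    by (simp flip: iter add: LIMSEQ_const_iff)
  then show ?thesis
    using summable_sums[OF sm[OF x]] by (simp add: V_def f_def[abs_def])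
qed

section \<open>Lambert series\<close>

lemma qpoch_inf_shift_tendsto_1:
  assumes q: "norm q < 1" and a: "norm a < 1"
  shows "(\<lambda>j. qpoch_inf (a * q ^ j) q) \<longlonglongrightarrow> 1"
proof -
  have "(\<lambda>j. qpoch_inf a q / qpoch a q j) \<longlonglongrightarrow> qpoch_inf a q / qpoch_inf a q"
    using qpoch_nonzero(2)[OF q a] by (intro tendsto_intros qpoch_tendsto q) auto
  moreover have "qpoch_inf a q / qpoch a q j = qpoch_inf (a * q ^ j) q" for j
    using qpoch_inf_split[OF q, of a j] qpoch_nonzero(1)[OF q a, of j] by simp
  ultimately show ?thesis
    using qpoch_nonzero(2)[OF q a] by simp
qed

lemma one_minus_power_lower_bound:
  fixes q :: complex
  assumes q: "norm q < 1"
  shows "1 - norm q \<le> norm (1 - q ^ Suc n)"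
  using norm_power_le_norm[OF q, of "Suc n"] norm_triangle_ineq2[of 1 "q ^ Suc n"] by simp

lemma norm_Lambert_term_le:
  fixes q :: complex
  assumes q: "norm q < 1"
  shows "norm (q ^ Suc n / (1 - q ^ Suc n)) \<le> norm q ^ n / (1 - norm q)"
  unfolding norm_divide norm_power
  using q one_minus_power_lower_bound[OF q, of n]
  by (intro frac_le power_decreasing) auto

lemma summable_Lambert_bound:
  fixes q :: complex
  assumes q: "norm q < 1"
  shows "summable (\<lambda>n. norm q ^ n / (1 - norm q))"
  using q by (intro summable_divide summable_geometric) auto

lemma summable_Lambert_minus:
  fixes q :: complex
  assumes q: "norm q < 1"
  shows "summable (\<lambda>n. q ^ Suc n / (1 - q ^ Suc n))"
  by (rule summable_comparison_test'[OF summable_Lambert_bound[OF q], of 0])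
    (rule norm_Lambert_term_le[OF q])

text \<open>The right side, seen as a function of \<open>a\<close>, obeys a first-order recurrence
  under the shift of \<open>a\<close> to aq. Weighting it by (a;q)_j makes it telescope. The later
  application takes a = -q.\<close>

lemma sums_qpoch_inf_diff:
  assumes q: "norm q < 1" and a: "norm a < 1"
  shows "(\<lambda>j. qpoch_inf a q / (1 - a * q ^ j) - qpoch a q j) sums
    (\<Sum>n. q ^ Suc n / (1 - q ^ Suc n) * (qpoch_inf a q - qpoch_inf (a * q ^ Suc n) q))"
proof -
  define P where "P j = qpoch_inf (a * q ^ j) q" for j
  define g where "g n = q ^ Suc n / (1 - q ^ Suc n)" for n
  \<comment> \<open>This is the right side with a q^j in place of \<open>a\<close>.\<close>
  define W where "W j = (\<Sum>n. g n * (P j - P (j + Suc n)))" for j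
  have P_lim: "P \<longlonglongrightarrow> 1"
    unfolding P_def using qpoch_inf_shift_tendsto_1[OF q a] .
  have P_Suc: "P j = (1 - a * q ^ j) * P (Suc j)" for j
    using qpoch_inf_split[OF q, of "a * q ^ j" 1] by (simp add: P_def qpoch_Suc mult_ac)
  have P_0: "P 0 = qpoch a q j * P j" for j
    using qpoch_inf_split[OF q, of a j] by (simp add: P_def)
  obtain K where K: "\<And>j. norm (P j) \<le> K"
    using convergent_imp_Bseq[OF convergentI[OF P_lim]] by (auto simp: Bseq_def)
  define M where "M n = norm q ^ n / (1 - norm q) * (K + K)" for n
  have M: "summable M"
    unfolding M_def by (intro summable_mult2 summable_Lambert_bound q)
  have le: "norm (g n * (P j - P (j + Suc n))) \<le> M n" for j n
    unfolding norm_mult M_def g_def using K[of j] K[of "j + Suc n"] q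
    by (intro mult_mono norm_Lambert_term_le q order.trans[OF norm_triangle_ineq4] add_mono) auto
  have sm: "summable (\<lambda>n. g n * (P j - P (j + Suc n)))" for j
    by (rule summable_comparison_test'[OF M]) (rule le)
  \<comment> \<open>For each n the combination contains the factor 1 - q^(n+1), which clears the
    denominator of \<open>g n\<close>; what remains telescopes in n, with limit 1 of
    \<open>P\<close> at infinity.\<close>
  have W_step: "W j - (1 - a * q ^ j) * W (Suc j) = P (Suc j) - 1" for j
  proof -
    have "(\<lambda>n. g n * (P j - P (j + Suc n)) - (1 - a * q ^ j) * (g n * (P (Suc j) - P (Suc j + Suc n))))
       sums (W j - (1 - a * q ^ j) * W (Suc j))"
      unfolding W_def by (intro sums_diff sums_mult summable_sums sm)
    moreover have "g n * (P j - P (j + Suc n)) - (1 - a * q ^ j) * (g n * (P (Suc j) - P (Suc j + Suc n)))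
        = P (Suc j + n) - P (Suc j + Suc n)" for n
    proof -
      have "1 - q ^ Suc n \<noteq> 0"
        using one_minus_power_lower_bound[OF q, of n] q by auto
      then have g: "g n * (1 - q ^ Suc n) = q ^ Suc n"
        by (simp add: g_def)
      have "g n * (P j - P (j + Suc n)) - (1 - a * q ^ j) * (g n * (P (Suc j) - P (Suc j + Suc n)))
        = g n * ((1 - a * q ^ j) * P (Suc (j + Suc n)) - P (j + Suc n))"
        unfolding P_Suc[of j] by (simp add: algebra_simps)
      also have "\<dots> = - (g n * (1 - q ^ Suc n)) * (a * q ^ j * P (Suc (j + Suc n)))"
        unfolding P_Suc[of "j + Suc n"] power_add by (simp add: algebra_simps)
      also have "\<dots> = P (j + Suc n) - P (Suc (j + Suc n))"
        unfolding g P_Suc[of "j + Suc n"] power_add by (simp add: algebra_simps)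
      finally show ?thesis by simp
    qed
    moreover have "(\<lambda>n. P (Suc j + n)) \<longlonglongrightarrow> 1"
      using LIMSEQ_ignore_initial_segment[OF P_lim, of "Suc j"] by (simp add: add.commute)
    then have "(\<lambda>n. P (Suc j + n) - P (Suc j + Suc n)) sums (P (Suc j + 0) - 1)"
      by (rule telescope_sums')
    ultimately show ?thesis
      using sums_unique2 by simp
  qed
  have "W \<longlonglongrightarrow> (\<Sum>n. 0)"
    unfolding W_def
  proof (rule tannery_sequentially[OF _ le M])
    fix n
    have "(\<lambda>j. g n * (P j - P (j + Suc n))) \<longlonglongrightarrow> g n * (1 - 1)"
      by (intro tendsto_intros P_lim LIMSEQ_ignore_initial_segment)
    then show "(\<lambda>j. g n * (P j - P (j + Suc n))) \<longlonglongrightarrow> 0" by simp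
  qed
  then have "(\<lambda>j. qpoch a q j * W j) \<longlonglongrightarrow> qpoch_inf a q * 0"
    by (intro tendsto_mult qpoch_tendsto q) simp
  then have "(\<lambda>j. qpoch a q j * W j - qpoch a q (Suc j) * W (Suc j)) sums (qpoch a q 0 * W 0 - 0)"
    by (intro telescope_sums') simp
  moreover have "qpoch a q j * W j - qpoch a q (Suc j) * W (Suc j)
      = qpoch_inf a q / (1 - a * q ^ j) - qpoch a q j" for j
  proof -
    have "1 - a * q ^ j \<noteq> 0"
      using qpoch_nonzero(1)[OF q a, of "Suc j"] by (simp add: qpoch_Suc)
    have "qpoch a q j * W j - qpoch a q (Suc j) * W (Suc j)
        = qpoch a q j * (W j - (1 - a * q ^ j) * W (Suc j))"
      by (simp add: qpoch_Suc algebra_simps)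
    also have "\<dots> = qpoch a q j * P (Suc j) - qpoch a q j"
      unfolding W_step by (simp add: right_diff_distrib)
    also have "qpoch a q j * P (Suc j) = P 0 / (1 - a * q ^ j)"
      using \<open>1 - a * q ^ j \<noteq> 0\<close> P_0[of "Suc j"] by (simp add: qpoch_Suc)
    finally show ?thesis by (simp add: P_def)
  qed
  ultimately show ?thesis
    by (simp add: W_def P_def g_def)
qed

section \<open>Summing the deviations of 1/(q;q)_k from their limit\<close>

lemma inverse_qpoch_diff:
  assumes q: "norm q < 1"
  shows "1 / qpoch q q (Suc k) - 1 / qpoch q q k = q ^ Suc k / qpoch q q (Suc k)"
proof -
  have "qpoch q q k \<noteq> 0" "1 - q * q ^ k \<noteq> 0"
    using qpoch_nonzero(1)[OF q q, of "Suc k"] by (auto simp: qpoch_Suc)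
  then show ?thesis
    by (simp add: qpoch_Suc field_simps)
qed

lemma inverse_qpoch_tendsto:
  assumes q: "norm q < 1"
  shows "(\<lambda>k. 1 / qpoch q q k) \<longlonglongrightarrow> 1 / qpoch_inf q q"
  using qpoch_nonzero(2)[OF q q] by (intro tendsto_intros qpoch_tendsto q)

text \<open>Behind this is x F'(x) at x = q for F(x) = sum x^k/(q;q)_k = 1/(x;q)_inf, whose
  logarithmic derivative is a Lambert series. Instead of differentiating, the q-difference equations
  of both series are iterated along x = q^(j+1).\<close>

lemma sums_of_nat_power_div_qpoch:
  assumes q: "norm q < 1"
  shows "(\<lambda>k. of_nat k * q ^ k / qpoch q q k) sums
    ((\<Sum>n. q ^ Suc n / (1 - q ^ Suc n)) / qpoch_inf q q)"
proof -
  obtain C where C: "C > 0" "\<And>n. norm (1 / qpoch q q n) \<le> C"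
    using obtain_qpoch_bounds[OF q] by blast
  define M where "M k = of_nat (Suc k) * norm q ^ k * C" for k
  have M: "summable M"
    unfolding M_def by (intro summable_mult2 summable_of_nat_power) (use q in auto)
  \<comment> \<open>\<open>f j k\<close> and \<open>h j k\<close> are the k-th terms of F(x) and x
    F'(x) at x = q^(j+1), with sums \<open>e j\<close> and \<open>z j\<close>.\<close>
  define f where "f j k = (q ^ Suc j) ^ k / qpoch q q k" for j k
  define h where "h j k = of_nat k * f j k" for j k
  define e where "e j = (\<Sum>k. f j k)" for j
  define z where "z j = (\<Sum>k. h j k)" for j
  have f_le': "norm (f j k) \<le> norm q ^ k * C" for j k
  proof -
    have "norm ((q ^ Suc j) ^ k) \<le> norm q ^ k"
      unfolding norm_power[of "q ^ Suc j"] using norm_power_le_norm[OF q, of "Suc j"]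
      by (intro power_mono) auto
    then have "norm ((q ^ Suc j) ^ k) * norm (1 / qpoch q q k) \<le> norm q ^ k * C"
      using C by (intro mult_mono) auto
    then show ?thesis by (simp add: f_def norm_divide)
  qed
  have f_le: "norm (f j k) \<le> M k" for j k
    using f_le'[of j k] mult_right_mono[of 1 "of_nat (Suc k)" "norm q ^ k * C"] C(1)
    by (simp add: M_def mult.assoc)
  have h_le: "norm (h j k) \<le> M k" for j k
    unfolding h_def norm_mult M_def mult.assoc using C(1)
    by (intro mult_mono f_le') auto
  have smf: "summable (f j)" for j
    by (rule summable_comparison_test'[OF M]) (rule f_le)
  have smh: "summable (h j)" for j
    by (rule summable_comparison_test'[OF M]) (rule h_le)
  have f_Suc: "f j (Suc k) - f (Suc j) (Suc k) = q ^ Suc j * f j k" for j k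
  proof -
    have nz: "qpoch q q k \<noteq> 0" "1 - q * q ^ k \<noteq> 0"
      using qpoch_nonzero(1)[OF q q, of "Suc k"] by (auto simp: qpoch_Suc)
    have "(q ^ Suc (Suc j)) ^ Suc k = (q ^ Suc j) ^ Suc k * (q * q ^ k)"
      by (simp add: power_mult_distrib)
    then have "f j (Suc k) - f (Suc j) (Suc k)
        = (q ^ Suc j) ^ Suc k * (1 - q * q ^ k) / qpoch q q (Suc k)"
      unfolding f_def by (simp only: ring_distribs diff_divide_distrib mult_1_right)
    then show ?thesis
      using nz by (simp add: f_def qpoch_Suc)
  qed
  have h_Suc: "h j (Suc k) - h (Suc j) (Suc k) = q ^ Suc j * (h j k + f j k)" for j k
  proof -
    have "h j (Suc k) - h (Suc j) (Suc k) = of_nat (Suc k) * (f j (Suc k) - f (Suc j) (Suc k))"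
      by (simp add: h_def right_diff_distrib)
    then show ?thesis
      unfolding f_Suc by (simp add: h_def algebra_simps)
  qed
  have e_step: "e (Suc j) = (1 - q ^ Suc j) * e j" for j
  proof -
    have "(\<lambda>k. f j (Suc k) - f (Suc j) (Suc k)) sums ((e j - f j 0) - (e (Suc j) - f (Suc j) 0))"
      unfolding e_def using smf by (intro sums_diff) (simp_all add: sums_Suc_iff summable_sums)
    moreover have "(\<lambda>k. q ^ Suc j * f j k) sums (q ^ Suc j * e j)"
      unfolding e_def by (intro sums_mult summable_sums smf)
    ultimately have "(e j - f j 0) - (e (Suc j) - f (Suc j) 0) = q ^ Suc j * e j"
      unfolding f_Suc by (rule sums_unique2)
    then show ?thesis by (simp add: f_def algebra_simps)
  qed
  have z_step: "(1 - q ^ Suc j) * z j = z (Suc j) + q ^ Suc j * e j" for j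
  proof -
    have "(\<lambda>k. h j (Suc k) - h (Suc j) (Suc k)) sums ((z j - h j 0) - (z (Suc j) - h (Suc j) 0))"
      unfolding z_def using smh by (intro sums_diff) (simp_all add: sums_Suc_iff summable_sums)
    moreover have "(\<lambda>k. q ^ Suc j * (h j k + f j k)) sums (q ^ Suc j * (z j + e j))"
      unfolding e_def z_def by (intro sums_mult sums_add summable_sums smf smh)
    ultimately have "(z j - h j 0) - (z (Suc j) - h (Suc j) 0) = q ^ Suc j * (z j + e j)"
      unfolding h_Suc by (rule sums_unique2)
    then show ?thesis by (simp add: h_def algebra_simps)
  qed
  have nz: "qpoch q q j \<noteq> 0" "1 - q ^ Suc j \<noteq> 0" for j
    using qpoch_nonzero(1)[OF q q, of "Suc j"] by (auto simp: qpoch_Suc)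
  have pow_lim: "(\<lambda>j. q ^ Suc j) \<longlonglongrightarrow> 0"
    using LIMSEQ_Suc[OF LIMSEQ_power_zero[OF q]] by simp
  have f_lim: "(\<lambda>j. f j k) \<longlonglongrightarrow> (if k = 0 then 1 else 0)" for k
  proof -
    have "(\<lambda>j. f j k) \<longlonglongrightarrow> 0 ^ k / qpoch q q k"
      unfolding f_def using nz by (intro tendsto_intros pow_lim) auto
    then show ?thesis by (simp add: power_0_left split: if_splits)
  qed
  have "e \<longlonglongrightarrow> (\<Sum>k. if k = 0 then 1 else 0)"
    unfolding e_def by (rule tannery_sequentially[OF f_lim f_le M])
  then have e_lim: "e \<longlonglongrightarrow> 1"
    using suminf_finite[of "{0}" "\<lambda>k. if k = 0 then 1 else (0::complex)"] by simp
  have e_eq: "e j = qpoch q q j * e 0" for j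
    by (induction j) (simp_all add: e_step qpoch_Suc)
  have "(\<lambda>j. qpoch q q j * e 0) \<longlonglongrightarrow> qpoch_inf q q * e 0"
    by (intro tendsto_mult_right qpoch_tendsto q)
  then have "e \<longlonglongrightarrow> qpoch_inf q q * e 0"
    by (simp only: e_eq[symmetric])
  then have "qpoch_inf q q * e 0 = 1"
    using e_lim by (rule LIMSEQ_unique)
  then have e_0: "e 0 = 1 / qpoch_inf q q"
    using qpoch_nonzero(2)[OF q q] by (simp add: field_simps)
  have "z \<longlonglongrightarrow> (\<Sum>k. 0)"
    unfolding z_def
  proof (rule tannery_sequentially[OF _ h_le M])
    fix k
    have "(\<lambda>j. h j k) \<longlonglongrightarrow> of_nat k * (if k = 0 then 1 else 0)"
      unfolding h_def by (intro tendsto_mult_left f_lim)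
    then show "(\<lambda>j. h j k) \<longlonglongrightarrow> 0" by (simp split: if_splits)
  qed
  \<comment> \<open>Division by (q;q)_j removes the factor in \<open>z_step\<close>, and
    \<open>e_eq\<close> reduces the inhomogeneous part to \<open>e 0\<close> times a Lambert term,
    so that \<open>z 0\<close> is a telescoping sum.\<close>
  then have "(\<lambda>j. z j / qpoch q q j) \<longlonglongrightarrow> 0 / qpoch_inf q q"
    using qpoch_nonzero(2)[OF q q] by (intro tendsto_divide qpoch_tendsto q) simp_all
  then have "(\<lambda>j. z j / qpoch q q j - z (Suc j) / qpoch q q (Suc j)) sums (z 0 / qpoch q q 0 - 0)"
    by (intro telescope_sums') simp
  moreover have "z j / qpoch q q j - z (Suc j) / qpoch q q (Suc j) = e 0 * (q ^ Suc j / (1 - q ^ Suc j))" for j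
  proof -
    have "z (Suc j) = (1 - q ^ Suc j) * z j - q ^ Suc j * (qpoch q q j * e 0)"
      using z_step[of j] e_eq[of j] by (simp add: algebra_simps)
    then show ?thesis
      using nz[of j] by (simp add: qpoch_Suc divide_simps)
  qed
  ultimately have "(\<lambda>j. e 0 * (q ^ Suc j / (1 - q ^ Suc j))) sums z 0"
    by simp
  moreover have "(\<lambda>j. e 0 * (q ^ Suc j / (1 - q ^ Suc j))) sums (e 0 * (\<Sum>n. q ^ Suc n / (1 - q ^ Suc n)))"
    by (intro sums_mult summable_sums summable_Lambert_minus q)
  ultimately have "z 0 = (\<Sum>n. q ^ Suc n / (1 - q ^ Suc n)) / qpoch_inf q q"
    using sums_unique2 e_0 by fastforce
  moreover have "h 0 sums z 0"
    unfolding z_def by (intro summable_sums smh)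
  ultimately show ?thesis
    by (simp add: h_def[abs_def] f_def)
qed

text \<open>Summation by parts: the sum of \<open>d k\<close> over k < N is N d_N plus the partial
  sum of (k+1) t_{k+1}. The boundary term vanishes because \<open>d\<close> decays geometrically,
  and the rest is the preceding series.\<close>

lemma sums_inverse_qpoch_diff:
  assumes q: "norm q < 1"
  shows "(\<lambda>k. 1 / qpoch_inf q q - 1 / qpoch q q k) sums
    ((\<Sum>n. q ^ Suc n / (1 - q ^ Suc n)) / qpoch_inf q q)"
proof -
  define d where "d k = 1 / qpoch_inf q q - 1 / qpoch q q k" for k
  define t where "t k = q ^ k / qpoch q q k" for k
  have d_Suc: "d k - d (Suc k) = t (Suc k)" for k
    unfolding d_def t_def using inverse_qpoch_diff[OF q, of k] by simp
  obtain C where C: "C > 0" "\<And>n. norm (1 / qpoch q q n) \<le> C"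
    using obtain_qpoch_bounds[OF q] by blast
  have t_le: "norm (t k) \<le> C * norm q ^ k" for k
    using mult_right_mono[OF C(2)[of k], of "norm q ^ k"] by (simp add: t_def norm_divide norm_power)
  have d_lim: "d \<longlonglongrightarrow> 0"
    using tendsto_diff[OF tendsto_const inverse_qpoch_tendsto[OF q], of "1 / qpoch_inf q q"]
    by (simp add: d_def[abs_def])
  \<comment> \<open>Since \<open>d\<close> tends to 0, \<open>d N\<close> is the sum of the terms
    \<open>t k\<close> with k > N.\<close>
  have d_le: "norm (d N) \<le> C * norm q ^ N / (1 - norm q)" for N
  proof -
    have "(\<lambda>k. d (k + N)) \<longlonglongrightarrow> 0"
      using d_lim by (rule LIMSEQ_ignore_initial_segment)
    from telescope_sums'[OF this] have "(\<lambda>k. t (Suc k + N)) sums d N"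
      by (simp add: d_Suc)
    moreover have "(\<lambda>k. C * norm q ^ N * norm q ^ k) sums (C * norm q ^ N * (1 / (1 - norm q)))"
      using q by (intro sums_mult geometric_sums) auto
    moreover have "norm (t (Suc k + N)) \<le> C * norm q ^ N * norm q ^ k" for k
    proof -
      have "C * norm q ^ (Suc k + N) \<le> C * norm q ^ (N + k)"
        using q C(1) by (intro mult_left_mono power_decreasing) auto
      then show ?thesis
        using t_le[of "Suc k + N"] by (simp add: power_add mult_ac)
    qed
    ultimately show ?thesis
      using norm_sums_le by fastforce
  qed
  have "(\<lambda>N. of_nat N * norm q ^ N) \<longlonglongrightarrow> 0"
    using q by (intro powser_times_n_limit_0) auto
  then have "(\<lambda>N. C / (1 - norm q) * (of_nat N * norm q ^ N)) \<longlonglongrightarrow> C / (1 - norm q) * 0"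
    by (rule tendsto_mult_left)
  then have "(\<lambda>N. C / (1 - norm q) * (of_nat N * norm q ^ N)) \<longlonglongrightarrow> 0"
    by simp
  moreover have "norm (of_nat N * d N) \<le> C / (1 - norm q) * (of_nat N * norm q ^ N)" for N
    using mult_left_mono[OF d_le, of "of_nat N" N] by (simp add: norm_mult mult_ac)
  then have "\<forall>\<^sub>F N in sequentially. norm (of_nat N * d N) \<le> C / (1 - norm q) * (of_nat N * norm q ^ N)"
    by simp
  ultimately have lim0: "(\<lambda>N. of_nat N * d N) \<longlonglongrightarrow> 0"
    by (rule Lim_null_comparison[rotated])
  define S where "S = (\<Sum>n. q ^ Suc n / (1 - q ^ Suc n)) / qpoch_inf q q"
  have "(\<lambda>k. of_nat k * t k) sums S"
    using sums_of_nat_power_div_qpoch[OF q] by (simp add: S_def t_def)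
  then have "(\<lambda>k. of_nat (Suc k) * t (Suc k)) sums S"
    using sums_Suc_iff[of "\<lambda>k. of_nat k * t k" S] by (simp del: of_nat_Suc)
  then have "(\<lambda>N. of_nat N * d N + (\<Sum>k<N. of_nat (Suc k) * t (Suc k))) \<longlonglongrightarrow> 0 + S"
    unfolding sums_def by (rule tendsto_add[OF lim0])
  moreover have "of_nat N * d N + (\<Sum>k<N. of_nat (Suc k) * t (Suc k)) = (\<Sum>k<N. d k)" for N
    by (induction N) (simp_all add: algebra_simps flip: d_Suc)
  ultimately have "d sums S"
    by (simp add: sums_def)
  then show ?thesis
    by (simp add: S_def d_def[abs_def])
qed

section \<open>Triangular exponents\<close>

lemma sums_tail:
  fixes f :: "nat \<Rightarrow> 'a :: real_normed_vector"
  assumes "f sums s"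
  shows "(\<lambda>n. f (Suc n)) sums (s - f 0)"
  using assms sums_Suc_iff[of f "s - f 0"] by simp

text \<open>The common majorant for series with triangular exponents. Its linear factor accommodates
  partial sums of bounded sequences as well as the bounded sequences themselves.\<close>

lemma summable_linear_power:
  fixes q :: complex
  assumes q: "norm q < 1"
  shows "summable (\<lambda>i. norm q ^ i * (K * real (Suc i)))"
  using summable_mult[OF summable_of_nat_power[of "norm q"], of K] q by (simp add: mult_ac)

lemma norm_power_choose_2_mult_le:
  fixes q b :: complex
  assumes "norm q < 1" "norm b \<le> K * real (Suc i)"
  shows "norm (q ^ (Suc i choose 2) * b) \<le> norm q ^ i * (K * real (Suc i))"
  unfolding norm_mult using assms
  by (intro mult_mono norm_power_choose_2_le) auto

lemma summable_power_choose_2_mult: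
  fixes q :: complex
  assumes "norm q < 1" "\<And>i. norm (b i) \<le> K * real (Suc i)"
  shows "summable (\<lambda>i. q ^ (Suc i choose 2) * b i)"
  by (rule summable_comparison_test'[OF summable_linear_power[OF assms(1)]])
    (rule norm_power_choose_2_mult_le[OF assms])

lemma tannery_power_choose_2:
  fixes q :: complex
  assumes "norm q < 1" "\<And>n i. norm (b n i) \<le> K * real (Suc i)"
    and "\<And>i. (\<lambda>n. b n i) \<longlonglongrightarrow> c i"
  shows "(\<lambda>n. \<Sum>i. q ^ (Suc i choose 2) * b n i) \<longlonglongrightarrow> (\<Sum>i. q ^ (Suc i choose 2) * c i)"
  by (rule tannery_sequentially[OF tendsto_mult_left[OF assms(3)]
        norm_power_choose_2_mult_le[OF assms(1,2)] summable_linear_power[OF assms(1)]])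

lemma inverse_qpoch_le_linear:
  assumes q: "norm q < 1"
  shows "\<exists>C>0. \<forall>n i. norm (1 / qpoch q q n) \<le> C * real (Suc i)"
proof -
  obtain C where C: "C > 0" "\<And>n. norm (1 / qpoch q q n) \<le> C"
    using obtain_qpoch_bounds[OF q] by blast
  have "norm (1 / qpoch q q n) \<le> C * real (Suc i)" for n i
    using order.trans[OF C(2)[of n], of "C * real (Suc i)"] C(1) by simp
  with C(1) show ?thesis by blast
qed

text \<open>The first sum collects the negative indices \<open>j = -1-i\<close> of the bilateral sum over \<open>j \<le> n\<close>,
  where \<open>j(j+1)/2 = i(i+1)/2\<close>.\<close>

lemma triangular_sum_qpoch:
  assumes q: "norm q < 1"
  shows "(\<Sum>i. q ^ (Suc i choose 2) * (1 / qpoch q q (Suc (n + i))))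
      + (\<Sum>i\<le>n. q ^ (Suc i choose 2) * (1 / qpoch q q (n - i)))
    = 2 * qpoch_inf (- q) q * qpoch (- q) q n"
proof -
  define T where "T i = q ^ (Suc i choose 2)" for i
  define u where "u k = 1 / qpoch q q k" for k
  define A where "A n = (\<Sum>i. T i * u (Suc (n + i)))" for n
  define B where "B n = (\<Sum>i\<le>n. T i * u (n - i))" for n
  obtain C where C: "\<And>n i. norm (u n) \<le> C * real (Suc i)"
    using inverse_qpoch_le_linear[OF q] unfolding u_def by blast
  have sm: "summable (\<lambda>i. T i * u (Suc (n + i)))" for n
    unfolding T_def by (rule summable_power_choose_2_mult[OF q C])
  have T_Suc: "T (Suc i) = T i * q ^ Suc i" for i
    unfolding T_def by (rule power_choose_2_Suc)
  have T_0: "T 0 = 1"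
    by (simp add: T_def numeral_2_eq_2)
  have u_Suc: "u (Suc k) - u k = q ^ Suc k * u (Suc k)" for k
    using inverse_qpoch_diff[OF q, of k] by (simp add: u_def)
  \<comment> \<open>Increments of \<open>u\<close> raise the triangular exponent, so the sum is
    reproduced without its first term. The same term appears with opposite sign in
    \<open>B_step\<close>, hence \<open>A n + B n\<close> acquires just the factor 1 +
    q^(n+1).\<close>
  have A_step: "A (Suc n) - A n = q ^ Suc n * (A n - u (Suc n))" for n
  proof -
    have "(\<lambda>i. T i * u (Suc (Suc n + i)) - T i * u (Suc (n + i))) sums (A (Suc n) - A n)"
      unfolding A_def by (intro sums_diff summable_sums sm)
    moreover have "T i * u (Suc (Suc n + i)) - T i * u (Suc (n + i))
        = q ^ Suc n * (T (Suc i) * u (Suc (n + Suc i)))" for i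
    proof -
      have "T i * u (Suc (Suc n + i)) - T i * u (Suc (n + i))
          = T i * (u (Suc (Suc (n + i))) - u (Suc (n + i)))"
        by (simp add: algebra_simps)
      also have "\<dots> = q ^ Suc n * (T (Suc i) * u (Suc (n + Suc i)))"
        unfolding u_Suc T_Suc by (simp add: power_add)
      finally show ?thesis .
    qed
    moreover have "(\<lambda>i. q ^ Suc n * (T (Suc i) * u (Suc (n + Suc i)))) sums (q ^ Suc n * (A n - T 0 * u (Suc (n + 0))))"
      unfolding A_def using sums_tail[OF summable_sums[OF sm[of n]]] by (intro sums_mult)
    ultimately show ?thesis
      using sums_unique2 by (simp add: T_0)
  qed
  have B_step: "B (Suc n) - B n = q ^ Suc n * (B n + u (Suc n))" for n
  proof -
    \<comment> \<open>For i up to n this is the increment of the i-th term; at i = n + 1 it is the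
      new last term of \<open>B (Suc n)\<close>.\<close>
    define v where "v i = T i * (q ^ (Suc n - i) * u (Suc n - i))" for i
    have "B (Suc n) = (\<Sum>i\<le>n. T i * u (n - i) + v i) + v (Suc n)"
    proof -
      have "T i * u (Suc n - i) = T i * u (n - i) + v i" if "i \<le> n" for i
      proof -
        have "u (Suc n - i) = u (n - i) + q ^ (Suc n - i) * u (Suc n - i)"
          using u_Suc[of "n - i"] that by (simp add: Suc_diff_le algebra_simps)
        then show ?thesis
          unfolding v_def by (metis distrib_left)
      qed
      then show ?thesis
        by (simp add: B_def v_def)
    qed
    then have "B (Suc n) - B n = (\<Sum>i\<le>Suc n. v i)"
      by (simp add: B_def sum.distrib)
    also have "\<dots> = v 0 + (\<Sum>i\<le>n. v (Suc i))"
      by (rule sum.atMost_Suc_shift)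
    also have "(\<Sum>i\<le>n. v (Suc i)) = (\<Sum>i\<le>n. q ^ Suc n * (T i * u (n - i)))"
    proof (rule sum.cong)
      fix i assume "i \<in> {..n}"
      then have "q ^ n = q ^ i * q ^ (n - i)"
        by (simp flip: power_add)
      then show "v (Suc i) = q ^ Suc n * (T i * u (n - i))"
        unfolding v_def T_Suc by simp
    qed simp
    finally show ?thesis
      by (simp add: v_def T_0 B_def sum_distrib_left ring_distribs)
  qed
  \<comment> \<open>The base case is Euler's expansion at x = 1, where \<open>A 0\<close> lacks the
    term k = 0 and \<open>B 0\<close> supplies it.\<close>
  have "(\<lambda>k. q ^ (k choose 2) * 1 ^ k / qpoch q q k) sums qpoch_inf (- 1) q"
    using euler_qpoch_inf[OF q, of 1] by simp
  then have "(\<lambda>i. T i * u (Suc (0 + i))) sums (qpoch_inf (- 1) q - 1)"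
    using sums_Suc_iff[of "\<lambda>k. q ^ (k choose 2) * 1 ^ k / qpoch q q k" "qpoch_inf (- 1) q - 1"]
    by (simp add: T_def u_def binomial_eq_0)
  then have "A 0 = qpoch_inf (- 1) q - 1"
    unfolding A_def by (rule sums_unique[symmetric])
  moreover have "qpoch_inf (- 1) q = 2 * qpoch_inf (- q) q"
    using qpoch_inf_split[OF q, of "- 1" 1] by (simp add: qpoch_Suc)
  ultimately have "A 0 + B 0 = 2 * qpoch_inf (- q) q * qpoch (- q) q 0"
    by (simp add: B_def T_0 u_def)
  moreover have "A (Suc n) + B (Suc n) = (A n + B n) * (1 - - q * q ^ n)" for n
    using A_step[of n] B_step[of n] by (simp add: algebra_simps)
  ultimately have "A n + B n = 2 * qpoch_inf (- q) q * qpoch (- q) q n"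
    by (induction n) (simp_all add: qpoch_Suc)
  then show ?thesis
    by (simp add: A_def B_def T_def u_def)
qed

text \<open>Gauss's evaluation of the triangular-number series, as the limit of
  \<open>triangular_sum_qpoch\<close>: each of its two sums tends to the same multiple of that
  series.\<close>

lemma qpoch_inf_neg_square:
  assumes q: "norm q < 1"
  shows "(qpoch_inf (- q) q)\<^sup>2 = (\<Sum>i. q ^ (Suc i choose 2)) / qpoch_inf q q"
proof -
  define u where "u k = 1 / qpoch q q k" for k
  define L where "L = (\<Sum>i. q ^ (Suc i choose 2) * (1 / qpoch_inf q q))"
  \<comment> \<open>Extension by zero makes the finite sum a series, so that dominated convergence
    applies to it.\<close>
  define w where "w n i = (if i \<le> n then u (n - i) else 0)" for n i
  obtain C where C: "C > 0" "\<And>n i. norm (u n) \<le> C * real (Suc i)"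
    using inverse_qpoch_le_linear[OF q] unfolding u_def by blast
  have u_lim: "u \<longlonglongrightarrow> 1 / qpoch_inf q q"
    unfolding u_def by (rule inverse_qpoch_tendsto[OF q])
  have "(\<lambda>n. \<Sum>i. q ^ (Suc i choose 2) * u (Suc (n + i))) \<longlonglongrightarrow> L"
    unfolding L_def
  proof (rule tannery_power_choose_2[OF q C(2)])
    fix i
    show "(\<lambda>n. u (Suc (n + i))) \<longlonglongrightarrow> 1 / qpoch_inf q q"
      using LIMSEQ_ignore_initial_segment[OF u_lim, of "Suc i"] by simp
  qed
  moreover have "(\<lambda>n. \<Sum>i. q ^ (Suc i choose 2) * w n i) \<longlonglongrightarrow> L"
    unfolding L_def
  proof (rule tannery_power_choose_2[OF q, of _ C])
    fix n i
    show "norm (w n i) \<le> C * real (Suc i)"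
      using C(1) C(2)[of "n - i" i] by (simp add: w_def)
    have "(\<lambda>n. w (n + i) i) \<longlonglongrightarrow> 1 / qpoch_inf q q"
      using u_lim by (simp add: w_def)
    then show "(\<lambda>n. w n i) \<longlonglongrightarrow> 1 / qpoch_inf q q"
      by (rule LIMSEQ_offset)
  qed
  ultimately have "(\<lambda>n. (\<Sum>i. q ^ (Suc i choose 2) * u (Suc (n + i)))
      + (\<Sum>i. q ^ (Suc i choose 2) * w n i)) \<longlonglongrightarrow> L + L"
    by (rule tendsto_add)
  moreover have "(\<Sum>i. q ^ (Suc i choose 2) * w n i) = (\<Sum>i\<le>n. q ^ (Suc i choose 2) * u (n - i))" for n
    by (subst suminf_finite[of "{..n}"]) (auto simp: w_def)
  ultimately have "(\<lambda>n. 2 * qpoch_inf (- q) q * qpoch (- q) q n) \<longlonglongrightarrow> L + L"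
    by (simp only: u_def triangular_sum_qpoch[OF q])
  moreover have "(\<lambda>n. 2 * qpoch_inf (- q) q * qpoch (- q) q n) \<longlonglongrightarrow> 2 * qpoch_inf (- q) q * qpoch_inf (- q) q"
    by (intro tendsto_mult_left qpoch_tendsto q)
  ultimately have "2 * qpoch_inf (- q) q * qpoch_inf (- q) q = L + L"
    by (rule LIMSEQ_unique[rotated])
  then have "(qpoch_inf (- q) q)\<^sup>2 = L"
    by (simp add: power2_eq_square)
  moreover have "summable (\<lambda>i. q ^ (Suc i choose 2))"
    using summable_power_choose_2_mult[OF q, of "\<lambda>_. 1" 1] by simp
  then have "L = (\<Sum>i. q ^ (Suc i choose 2)) / qpoch_inf q q"
    unfolding L_def by (subst suminf_mult2[symmetric]) simp_all
  ultimately show ?thesis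
    by simp
qed

section \<open>Partial sums of 1/(q;q)_k and the series R(q)\<close>

lemma norm_sum_inverse_qpoch_le:
  assumes q: "norm q < 1"
  shows "\<exists>C>0. \<forall>n. norm (\<Sum>k\<le>n. 1 / qpoch q q k) \<le> C * real (Suc n)"
proof -
  obtain C where C: "C > 0" "\<And>n. norm (1 / qpoch q q n) \<le> C"
    using obtain_qpoch_bounds[OF q] by blast
  have "norm (\<Sum>k\<le>n. 1 / qpoch q q k) \<le> C * real (Suc n)" for n
    using sum_norm_bound[of "{..n}" "\<lambda>k. 1 / qpoch q q k", OF C(2)] by (simp add: mult.commute)
  with C(1) show ?thesis by blast
qed

text \<open>The exponent is split so that the factors depending on i match Euler's series at x =
  q^(m+1).\<close>

lemma power_choose_2_add:
  "q ^ (Suc (m + i) choose 2)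
    = q ^ (Suc m choose 2) * (q ^ (i choose 2) * ((q :: 'a :: comm_monoid_mult) ^ Suc m) ^ i)"
proof (induction i)
  case (Suc i)
  have "q ^ (Suc (m + Suc i) choose 2) = q ^ (Suc (m + i) choose 2) * q ^ Suc (m + i)"
    using power_choose_2_Suc[of q "Suc (m + i)"] by simp
  also have "\<dots> = q ^ (Suc m choose 2) * (q ^ (i choose 2) * q ^ i * (q ^ Suc m) ^ Suc i)"
    unfolding Suc.IH by (simp add: power_add mult_ac)
  finally show ?case
    by (simp only: power_choose_2_Suc[of q i])
qed (simp add: binomial_eq_0)

text \<open>The quotient of (-q;q)_inf by (-q;q)_m is (-q^(m+1);q)_inf. Expanding it by Euler and
  collecting equal triangular exponents m + k gives the right side; a telescoping sum replaces the
  rearrangement of the double series.\<close>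

lemma qpoch_inf_neg_mult_R:
  assumes q: "norm q < 1"
  shows "qpoch_inf (- q) q * R q = (\<Sum>i. q ^ (Suc i choose 2) * (\<Sum>k\<le>i. 1 / qpoch q q k))"
proof -
  define T where "T i = q ^ (Suc i choose 2)" for i
  define s where "s i = (\<Sum>k\<le>i. 1 / qpoch q q k)" for i
  \<comment> \<open>This is the part of the collected double series with outer index at least
    m.\<close>
  define Q where "Q m = (\<Sum>i. T (m + i) * s i)" for m
  obtain C where C: "C > 0" "\<And>n. norm (s n) \<le> C * real (Suc n)"
    using norm_sum_inverse_qpoch_le[OF q] unfolding s_def by blast
  have le: "norm (T (m + i) * s i) \<le> norm q ^ i * (C * real (Suc i))" for m i
    unfolding norm_mult T_def using q C
    by (intro mult_mono order.trans[OF norm_power_choose_2_le[OF q]] power_decreasing) auto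
  have sm: "summable (\<lambda>i. T (m + i) * s i)" for m
    by (rule summable_comparison_test'[OF summable_linear_power[OF q]]) (rule le)
  have T_lim: "T \<longlonglongrightarrow> 0"
  proof -
    have "summable T"
      using summable_power_choose_2_mult[OF q, of "\<lambda>_. 1" 1] by (simp add: T_def[abs_def])
    then show ?thesis by (rule summable_LIMSEQ_zero)
  qed
  have "Q \<longlonglongrightarrow> (\<Sum>i. 0)"
    unfolding Q_def
  proof (rule tannery_sequentially[OF _ le summable_linear_power[OF q]])
    fix i
    show "(\<lambda>m. T (m + i) * s i) \<longlonglongrightarrow> 0"
      using tendsto_mult_right[OF LIMSEQ_ignore_initial_segment[OF T_lim, of i], of "s i"] by simp
  qed
  then have "(\<lambda>m. Q m - Q (Suc m)) sums (Q 0 - 0)"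
    by (intro telescope_sums') simp
  moreover have "Q m - Q (Suc m) = qpoch_inf (- q) q * (q ^ (Suc m choose 2) / qpoch (- q) q m)" for m
  proof -
    have "norm (q ^ Suc m) \<le> 1"
      using norm_power_le_norm[OF q, of "Suc m"] q by simp
    from sums_mult[OF euler_qpoch_inf[OF q this], of "T m"]
    have E: "(\<lambda>i. T (m + i) * (1 / qpoch q q i)) sums (T m * qpoch_inf (- (q ^ Suc m)) q)"
      unfolding T_def power_choose_2_add by (simp add: mult.assoc)
    have "(\<lambda>i. T (m + Suc i) * s (Suc i) - T (Suc m + i) * s i) sums (Q m - T (m + 0) * s 0 - Q (Suc m))"
      unfolding Q_def using sums_tail[OF summable_sums[OF sm[of m]]]
      by (intro sums_diff summable_sums sm)
    moreover have "T (m + Suc i) * s (Suc i) - T (Suc m + i) * s i = T (m + Suc i) * (1 / qpoch q q (Suc i))" for i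
      by (simp add: s_def algebra_simps)
    moreover have "(\<lambda>i. T (m + Suc i) * (1 / qpoch q q (Suc i))) sums
        (T m * qpoch_inf (- (q ^ Suc m)) q - T (m + 0) * (1 / qpoch q q 0))"
      by (rule sums_tail[OF E])
    ultimately have "Q m - T (m + 0) * s 0 - Q (Suc m)
        = T m * qpoch_inf (- (q ^ Suc m)) q - T (m + 0) * (1 / qpoch q q 0)"
      using sums_unique2 by simp
    then have "Q m - Q (Suc m) = T m * qpoch_inf (- (q ^ Suc m)) q"
      by (simp add: s_def algebra_simps)
    moreover have "qpoch_inf (- q) q = qpoch (- q) q m * qpoch_inf (- (q ^ Suc m)) q"
      using qpoch_inf_split[OF q, of "- q" m] by simp
    moreover have "qpoch (- q) q m \<noteq> 0"
      using qpoch_nonzero(1)[OF q, of "- q"] q by simp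
    ultimately show ?thesis
      by (simp add: T_def)
  qed
  moreover have "(\<lambda>m. qpoch_inf (- q) q * (q ^ (Suc m choose 2) / qpoch (- q) q m)) sums (qpoch_inf (- q) q * R q)"
    unfolding R_def by (intro sums_mult summable_sums summable_R q)
  ultimately have "Q 0 = qpoch_inf (- q) q * R q"
    using sums_unique2 by simp
  then show ?thesis
    by (simp add: Q_def T_def s_def)
qed

text \<open>Summing \<open>triangular_sum_qpoch\<close> over n < N gives the partial sums as (2 N
  P^2 - X N + P R(q))/(2P). By Gauss's evaluation of P^2, the divergent parts cancel inside one
  series with triangular exponents, whose limit is taken termwise.\<close>

lemma sums_qpoch_inf_neg_diff:
  assumes q: "norm q < 1"
  shows "(\<lambda>n. qpoch_inf (- q) q - qpoch (- q) q n) sums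
    (R q / 2 + qpoch_inf (- q) q * ((\<Sum>n. q ^ Suc n / (1 - q ^ Suc n)) - 1 / 2))"
proof -
  define T where "T i = q ^ (Suc i choose 2)" for i
  define u where "u k = 1 / qpoch q q k" for k
  define c where "c = 1 / qpoch_inf q q"
  define s where "s i = (\<Sum>k\<le>i. u k)" for i
  \<comment> \<open>The partial sums \<open>s\<close> grow linearly; \<sigma> is their convergent
    correction, with limit L c by the preceding section.\<close>
  define \<sigma> where "\<sigma> i = (\<Sum>k\<le>i. c - u k)" for i
  define L where "L = (\<Sum>n. q ^ Suc n / (1 - q ^ Suc n))"
  define P where "P = qpoch_inf (- q) q"
  have P_nz: "P \<noteq> 0"
    unfolding P_def using qpoch_nonzero(2)[OF q, of "- q"] q by simp
  have s_eq: "s i = of_nat (Suc i) * c - \<sigma> i" for i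
    by (simp add: s_def \<sigma>_def sum_subtractf)
  have \<sigma>_lim: "\<sigma> \<longlonglongrightarrow> L * c"
    using sums_inverse_qpoch_diff[OF q] unfolding sums_def_le
    by (simp add: \<sigma>_def[abs_def] c_def u_def L_def)
  obtain K where K: "\<And>i. norm (\<sigma> i) \<le> K"
    using convergent_imp_Bseq[OF convergentI[OF \<sigma>_lim]] by (auto simp: Bseq_def)
  have K_0: "K \<ge> 0"
    using order.trans[OF norm_ge_zero K] .
  obtain C where C: "\<And>i. norm (s i) \<le> C * real (Suc i)"
    using norm_sum_inverse_qpoch_le[OF q] unfolding s_def u_def by blast
  have sm: "summable (\<lambda>i. T i * s (N + i))" for N
    unfolding T_def
  proof (rule summable_power_choose_2_mult[OF q])
    fix i
    have "norm (s (N + i)) \<le> of_nat (Suc (N + i)) * norm c + K"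
      unfolding s_eq using K[of "N + i"] norm_triangle_ineq4[of "of_nat (Suc (N + i)) * c" "\<sigma> (N + i)"]
      by (simp add: norm_mult del: of_nat_Suc)
    also have "\<dots> \<le> (of_nat (Suc N) * norm c + K) * real (Suc i)"
    proof -
      have "real (Suc (N + i)) \<le> real (Suc N) * real (Suc i)"
        by (simp add: algebra_simps)
      from mult_right_mono[OF this, of "norm c"] show ?thesis
        using mult_left_mono[OF _ K_0, of 1 "real (Suc i)"] by (simp add: algebra_simps)
    qed
    finally show "norm (s (N + i)) \<le> (of_nat (Suc N) * norm c + K) * real (Suc i)" .
  qed
  \<comment> \<open>\<open>X N\<close> is the sum of \<open>2 P (-q;q)\<^sub>n\<close> over all integers \<open>n < N\<close>, with \<open>P R(q)\<close> for the negative ones.\<close>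
  define X where "X N = (\<Sum>i. T i * s (N + i)) + (\<Sum>i<N. T i * s (N - Suc i))" for N
  have X_0: "X 0 = P * R q"
    by (simp add: X_def P_def qpoch_inf_neg_mult_R[OF q] T_def s_def u_def)
  have X_step: "X (Suc N) - X N = 2 * P * qpoch (- q) q N" for N
  proof -
    have "(\<lambda>i. T i * s (Suc N + i) - T i * s (N + i)) sums ((\<Sum>i. T i * s (Suc N + i)) - (\<Sum>i. T i * s (N + i)))"
      by (intro sums_diff summable_sums sm)
    moreover have "T i * s (Suc N + i) - T i * s (N + i) = T i * u (Suc (N + i))" for i
      by (simp add: s_def algebra_simps)
    ultimately have 1: "(\<Sum>i. T i * s (Suc N + i)) - (\<Sum>i. T i * s (N + i)) = (\<Sum>i. T i * u (Suc (N + i)))"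
      by (simp add: sums_iff)
    have "(\<Sum>i<Suc N. T i * s (Suc N - Suc i)) = (\<Sum>i<N. T i * s (N - Suc i) + T i * u (N - i)) + T N * u 0"
    proof -
      have "T i * s (Suc N - Suc i) = T i * s (N - Suc i) + T i * u (N - i)" if "i < N" for i
      proof -
        have "N - i = Suc (N - Suc i)" using that by simp
        then show ?thesis by (simp add: s_def ring_distribs)
      qed
      then show ?thesis
        by (simp add: s_def)
    qed
    then have 2: "(\<Sum>i<Suc N. T i * s (Suc N - Suc i)) - (\<Sum>i<N. T i * s (N - Suc i)) = (\<Sum>i\<le>N. T i * u (N - i))"
      by (simp add: sum.distrib flip: lessThan_Suc_atMost)
    have "X (Suc N) - X N = (\<Sum>i. T i * u (Suc (N + i))) + (\<Sum>i\<le>N. T i * u (N - i))"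
      unfolding X_def 1[symmetric] 2[symmetric] by simp
    then show ?thesis
      using triangular_sum_qpoch[OF q, of N] by (simp add: T_def u_def P_def)
  qed
  have smT: "summable T"
    using summable_power_choose_2_mult[OF q, of "\<lambda>_. 1" 1] by (simp add: T_def[abs_def])
  have P_sq: "P\<^sup>2 = suminf T * c"
    using qpoch_inf_neg_square[OF q] by (simp add: P_def T_def[abs_def] c_def)
  \<comment> \<open>The coefficient of \<open>T i\<close> in 2 N P^2 - X N, with the finite sum in
    \<open>X N\<close> extended by zero.\<close>
  define y where "y N i = (of_nat N * c - s (N + i)) + (of_nat N * c - (if i < N then s (N - Suc i) else 0))" for N i
  \<comment> \<open>The two partial sums have (N+i+1) + (N-i) = 2N + 1 terms against 2N copies of
    \<open>c\<close>. The one left over is the source of the -1/2.\<close>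
  have y_eq: "y N i = \<sigma> (N + i) + \<sigma> (N - Suc i) - c" if "i < N" for N i
  proof -
    have "Suc (N - Suc i) = N - i" using that by simp
    then show ?thesis
      using that by (simp add: y_def s_eq algebra_simps of_nat_diff del: of_nat_Suc)
        (simp add: algebra_simps)
  qed
  have y_le: "norm (y N i) \<le> (2 * norm c + 2 * K) * real (Suc i)" for N i
  proof (cases "i < N")
    case True
    have "norm (y N i) \<le> (K + K) + norm c"
      unfolding y_eq[OF True]
      by (intro order.trans[OF norm_triangle_ineq4] add_mono order.trans[OF norm_triangle_ineq] K order.refl)
    also have "\<dots> \<le> (2 * norm c + 2 * K) * 1"
      by simp
    also have "\<dots> \<le> (2 * norm c + 2 * K) * real (Suc i)"
      using K_0 by (intro mult_left_mono) auto
    finally show ?thesis .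
  \<comment> \<open>Here the second partial sum is absent, and the surplus of \<open>c\<close> is at
    most i + 1 copies; this is where the linear majorant is used.\<close>
  next
    case False
    have "y N i = of_nat N * c - of_nat (Suc i) * c + \<sigma> (N + i)"
      using False by (simp add: y_def s_eq algebra_simps)
    also have "\<dots> = \<sigma> (N + i) - of_nat (Suc i - N) * c"
      using False by (simp add: of_nat_diff algebra_simps)
    finally have "norm (y N i) \<le> K + real (Suc i - N) * norm c"
      using norm_triangle_ineq4[of "\<sigma> (N + i)" "of_nat (Suc i - N) * c"] K[of "N + i"]
      by (simp add: norm_mult)
    also have "\<dots> \<le> 2 * K * real (Suc i) + 2 * norm c * real (Suc i)"
    proof (rule add_mono)
      show "K \<le> 2 * K * real (Suc i)"
        using mult_left_mono[OF _ K_0, of 1 "2 * real (Suc i)"] by (simp add: mult_ac)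
      have "real (Suc i - N) \<le> real (2 * Suc i)"
        by (intro of_nat_mono) simp
      then have "real (Suc i - N) \<le> 2 * real (Suc i)"
        by simp
      from mult_right_mono[OF this, of "norm c"]
      show "real (Suc i - N) * norm c \<le> 2 * norm c * real (Suc i)"
        by (simp add: mult_ac)
    qed
    finally show ?thesis
      by (simp add: algebra_simps)
  qed
  have Y_eq: "(\<Sum>i. T i * y N i) = 2 * of_nat N * P\<^sup>2 - X N" for N
  proof -
    have "(\<lambda>i. T i * (if i < N then s (N - Suc i) else 0)) sums (\<Sum>i<N. T i * (if i < N then s (N - Suc i) else 0))"
      by (rule sums_finite) auto
    then have "(\<lambda>i. T i * (if i < N then s (N - Suc i) else 0)) sums (\<Sum>i<N. T i * s (N - Suc i))"
      by simp
    then have "(\<lambda>i. 2 * of_nat N * (T i * c) - (T i * s (N + i) + T i * (if i < N then s (N - Suc i) else 0)))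
        sums (2 * of_nat N * (suminf T * c) - X N)"
      unfolding X_def by (intro sums_diff sums_add sums_mult sums_mult2 summable_sums sm smT)
    moreover have "2 * of_nat N * (T i * c) - (T i * s (N + i) + T i * (if i < N then s (N - Suc i) else 0)) = T i * y N i" for i
      by (simp add: y_def algebra_simps)
    ultimately show ?thesis
      by (simp add: sums_iff P_sq)
  qed
  have "(\<lambda>N. \<Sum>i. T i * y N i) \<longlonglongrightarrow> (\<Sum>i. T i * (L * c + L * c - c))"
    unfolding T_def
  proof (rule tannery_power_choose_2[OF q y_le])
    fix i
    \<comment> \<open>Shifting N by i + 1 ensures the case i < N, where \<open>y_eq\<close>
      holds.\<close>
    have "(\<lambda>N. \<sigma> ((N + Suc i) + i) + \<sigma> N - c) \<longlonglongrightarrow> L * c + L * c - c"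
      using LIMSEQ_ignore_initial_segment[OF \<sigma>_lim, of "Suc i + i"]
      by (intro tendsto_intros \<sigma>_lim) (simp add: add.assoc)
    moreover have "y (N + Suc i) i = \<sigma> ((N + Suc i) + i) + \<sigma> N - c" for N
      by (subst y_eq) simp_all
    ultimately have "(\<lambda>N. y (N + Suc i) i) \<longlonglongrightarrow> L * c + L * c - c"
      by simp
    then show "(\<lambda>N. y N i) \<longlonglongrightarrow> L * c + L * c - c"
      by (rule LIMSEQ_offset)
  qed
  also have "(\<Sum>i. T i * (L * c + L * c - c)) = suminf T * (L * c + L * c - c)"
    by (rule suminf_mult2[symmetric, OF smT])
  also have "\<dots> = P\<^sup>2 * (2 * L - 1)"
    unfolding P_sq by (simp add: algebra_simps)
  finally have "(\<lambda>N. (2 * of_nat N * P\<^sup>2 - X N + P * R q) / (2 * P))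
      \<longlonglongrightarrow> (P\<^sup>2 * (2 * L - 1) + P * R q) / (2 * P)"
    unfolding Y_eq using P_nz by (intro tendsto_intros) auto
  moreover have "(2 * of_nat N * P\<^sup>2 - X N + P * R q) / (2 * P) = (\<Sum>n<N. P - qpoch (- q) q n)" for N
  proof -
    have "2 * of_nat N * P\<^sup>2 - X N + P * R q = 2 * P * (\<Sum>n<N. P - qpoch (- q) q n)"
    proof (induction N)
      case (Suc N)
      have "X (Suc N) = X N + 2 * P * qpoch (- q) q N"
        using X_step[of N] by (simp add: algebra_simps)
      then show ?case
        using Suc.IH by (simp add: algebra_simps power2_eq_square)
    qed (simp add: X_0)
    then show ?thesis
      using P_nz by simp
  qed
  moreover have "(P\<^sup>2 * (2 * L - 1) + P * R q) / (2 * P) = R q / 2 + P * (L - 1 / 2)"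
    using P_nz by (simp add: field_simps power2_eq_square)
  ultimately show ?thesis
    by (simp add: sums_def P_def L_def)
qed

section \<open>Comparison of the two evaluations\<close>

theorem theorem3p3:
  fixes q :: complex
  assumes "norm q < 1"
  shows "(\<Sum>n. q ^ Suc n /
            (qpoch (q ^ Suc n) q (Suc n + 1) * qpoch_inf (q ^ (2 * Suc n + 1)) (q ^ 2)))
         = - (1 / 2) * R q + 1 / qpoch_inf q (q ^ 2) * (\<Sum>n. q ^ n / (1 + q ^ n))"
proof -
  note q = assms
  define P where "P = qpoch_inf (- q) q"
  define g where "g n = q ^ Suc n / (1 - q ^ Suc n)" for n
  define a where "a n = q ^ Suc n / (qpoch (q ^ Suc n) q (Suc n + 1) * qpoch_inf (q ^ (2 * Suc n + 1)) (q ^ 2))" for n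
  define l where "l n = q ^ n / (1 + q ^ n)" for n
  have mq: "norm (- q) < 1"
    using q by simp
  have a_eq: "a n = g n * qpoch_inf (- q * q ^ Suc n) q" for n
    unfolding a_def g_def using lhs_term_eq[OF q, of "Suc n"] by simp
  have sma: "summable a"
    unfolding a_def by (rule summable_lhs[OF q])
  have smg: "summable g"
    unfolding g_def by (rule summable_Lambert_minus[OF q])
  have sml: "summable l"
    unfolding l_def by (rule summable_Lambert[OF q])
  have "(\<lambda>n. g n * P - a n) sums (suminf g * P - suminf a)"
    by (intro sums_diff sums_mult2 summable_sums sma smg)
  moreover have "g n * P - a n = g n * (P - qpoch_inf (- q * q ^ Suc n) q)" for n
    by (simp add: a_eq algebra_simps)
  ultimately have "(\<Sum>n. g n * (P - qpoch_inf (- q * q ^ Suc n) q)) = suminf g * P - suminf a"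
    by (simp add: sums_iff)
  \<comment> \<open>The shift argument at a = -q.\<close>
  then have "(\<lambda>j. P / (1 - - q * q ^ j) - qpoch (- q) q j) sums (suminf g * P - suminf a)"
    using sums_qpoch_inf_diff[OF q mq] by (simp only: P_def g_def)
  \<comment> \<open>The subtracted 1/2 is the term n = 0. Adding these terms completes P/(1+q^(j+1))
    to P.\<close>
  moreover have "(\<lambda>j. P * l (Suc j)) sums (P * (suminf l - 1 / 2))"
    using sums_mult[OF sums_tail[OF summable_sums[OF sml]], of P] by (simp add: l_def)
  ultimately have "(\<lambda>j. P / (1 - - q * q ^ j) - qpoch (- q) q j + P * l (Suc j)) sums
      (suminf g * P - suminf a + P * (suminf l - 1 / 2))"
    by (rule sums_add)
  moreover have "P / (1 - - q * q ^ j) - qpoch (- q) q j + P * l (Suc j) = P - qpoch (- q) q j" for j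
  proof -
    have "1 + q ^ Suc j \<noteq> 0"
      using one_plus_power_lower_bound[OF q, of "Suc j"] q by auto
    moreover have "P / (1 + q ^ Suc j) + P * l (Suc j) = P * (1 + q ^ Suc j) / (1 + q ^ Suc j)"
      unfolding l_def by (simp only: ring_distribs add_divide_distrib times_divide_eq_right mult_1_right)
    ultimately have "P / (1 + q ^ Suc j) + P * l (Suc j) = P"
      by simp
    then show ?thesis by (simp add: algebra_simps)
  qed
  ultimately have "(\<lambda>j. P - qpoch (- q) q j) sums (suminf g * P - suminf a + P * (suminf l - 1 / 2))"
    by (simp only:)
  moreover have "(\<lambda>j. P - qpoch (- q) q j) sums (R q / 2 + P * (suminf g - 1 / 2))"
    using sums_qpoch_inf_neg_diff[OF q] by (simp add: P_def g_def[abs_def])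
  \<comment> \<open>Both the Lambert series \<open>suminf g\<close> and the term P/2 occur on each
    side and cancel.\<close>
  ultimately have "suminf g * P - suminf a + P * (suminf l - 1 / 2) = R q / 2 + P * (suminf g - 1 / 2)"
    by (rule sums_unique2)
  then have "suminf a = - (1 / 2) * R q + P * suminf l"
    by (simp add: algebra_simps)
  moreover have "P = 1 / qpoch_inf q (q ^ 2)"
    using qpoch_inf_odd_mult_neg[OF q] unfolding P_def
    by (metis mult_zero_left nonzero_mult_div_cancel_left zero_neq_one)
  ultimately show ?thesis
    by (simp add: a_def[abs_def] l_def[abs_def])
qed

end
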